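(* Let $(A_1,B_1),\dots,(A_k,B_k)\in\Sigma^2$ be a Streett acceptance condition, and suppose $$\mathsf P_\mu\Big(\bigcap_{i=1}^k\mathrm{Fin}(A_i)\cup\mathrm{Inf}(B_i)\Big)=1.$$ Then there exist a region $I\in\Sigma$ and regions $J_i\in\Sigma$ with $J_i\subseteq I\setminus A_i$ ($i=1,\dots,k$) such that $\mathsf P_\mu(I^\omega)=1$ and, for every $i=1,\dots,k$, $$\sup_{s\in J_i}\mathsf P_{\delta_s}(\sigma_{A_i}<\infty)<1\qquad\text{and}\qquad \inf_{s\in I}\mathsf P_{\delta_s}\big(\sigma_{B_i\cup J_i\cup I^{c}}<\infty\big)=1.$$
   Context: Setting. - $(S,\Sigma)$ is a measurable space. $\Omega=S^\omega$ carries the product $\sigma$-algebra, and $\Phi_n$ is the $n$-th coordinate map. - $\mu$ is a probability measure on $(S,\Sigma)$ and $P$ is a transition probability kernel. - $\mathsf P_\mu$ is the law of the time-homogeneous Markov chain $(\Phi_n)$ with initial distribution $\mu$ and kernel $P$. - $\mathsf P_{\delta_s}$ is the same law started from the Dirac measure at $s$. Events and times. - $\mathrm{Fin}(A)=\bigcup_{n}\bigcap_{m\ge n}\{\Phi_m\notin A\}$ and $\mathrm{Inf}(A)=\bigcap_n\bigcup_{m\ge n}\{\Phi_m\in A\}$. - The first return time is $\sigma_A=\inf\{n\ge1:\Phi_n\in A\}$, with $\inf\emptyset=\infty$. - $I^c=S\setminus I$ and $I^\omega=\{\Phi_n\in I\ \forall n\ge0\}$. - A Streett acceptance condition is a finite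 sequence of pairs in $\Sigma^2$. *)

theory Defs
  imports "HOL-Probability.Probability"
begin

definition path_space :: "'a measure \<Rightarrow> (nat \<Rightarrow> 'a) measure" where
  "path_space S = (\<Pi>\<^sub>M n\<in>UNIV. S)"

text \<open>One-step conditional laws of a Markov chain: the 0-th coordinate has law \<open>\<mu>\<close>, and
  given the coordinates \<open>\<omega> 0, \<dots>, \<omega> m\<close> the next one has law \<open>P (\<omega> m)\<close>.\<close>

definition markov_step ::
    "('a \<Rightarrow> 'a measure) \<Rightarrow> 'a measure \<Rightarrow> nat \<Rightarrow> (nat \<Rightarrow> 'a) \<Rightarrow> 'a measure" where
  "markov_step P \<mu> n \<omega> = (case n of 0 \<Rightarrow> \<mu> | Suc m \<Rightarrow> P (\<omega> m))"

text \<open>The Ionescu-Tulcea measure on path space of these conditional laws; it is meaningful when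
  \<open>\<mu>\<close> is a probability measure on \<open>S\<close> and \<open>P\<close> a probability kernel on \<open>S\<close>
  (see \<open>Ionescu_Tulcea_markov_step\<close> and the lemmas following it).\<close>

definition markov_law ::
    "'a measure \<Rightarrow> ('a \<Rightarrow> 'a measure) \<Rightarrow> 'a measure \<Rightarrow> (nat \<Rightarrow> 'a) measure" where
  "markov_law S P \<mu> =
     projective_family.lim UNIV (Ionescu_Tulcea.CI (markov_step P \<mu>) (\<lambda>_. S)) (\<lambda>_. S)"

definition Fin_event :: "'a measure \<Rightarrow> 'a set \<Rightarrow> (nat \<Rightarrow> 'a) set" where
  "Fin_event S A = (\<Union>n. \<Inter>m\<in>{n..}. {\<omega> \<in> space (path_space S). \<omega> m \<notin> A})"

definition Inf_event :: "'a measure \<Rightarrow> 'a set \<Rightarrow> (nat \<Rightarrow> 'a) set" where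
  "Inf_event S A = (\<Inter>n. \<Union>m\<in>{n..}. {\<omega> \<in> space (path_space S). \<omega> m \<in> A})"

definition return_time :: "'a set \<Rightarrow> (nat \<Rightarrow> 'a) \<Rightarrow> enat" where
  "return_time A \<omega> = Inf {enat n | n. 1 \<le> n \<and> \<omega> n \<in> A}"

definition always_event :: "'a measure \<Rightarrow> 'a set \<Rightarrow> (nat \<Rightarrow> 'a) set" where
  "always_event S I = {\<omega> \<in> space (path_space S). \<forall>n. \<omega> n \<in> I}"

definition return_event :: "'a measure \<Rightarrow> 'a set \<Rightarrow> (nat \<Rightarrow> 'a) set" where
  "return_event S A = {\<omega> \<in> space (path_space S). return_time A \<omega> < \<infinity>}"

text \<open>The intersection with the whole path space only matters for \<open>k = 0\<close>.\<close>

definition Streett_event ::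
    "'a measure \<Rightarrow> nat \<Rightarrow> (nat \<Rightarrow> 'a set) \<Rightarrow> (nat \<Rightarrow> 'a set) \<Rightarrow> (nat \<Rightarrow> 'a) set" where
  "Streett_event S k A B =
     space (path_space S) \<inter> (\<Inter>i\<in>{1..k}. Fin_event S (A i) \<union> Inf_event S (B i))"

lemma Ionescu_Tulcea_markov_step:
  fixes S \<mu> :: "'a measure" and P :: "'a \<Rightarrow> 'a measure"
  assumes P: "P \<in> measurable S (prob_algebra S)" and \<mu>: "\<mu> \<in> space (prob_algebra S)"
  shows "Ionescu_Tulcea (markov_step P \<mu>) (\<lambda>_. S)"
proof (rule Ionescu_Tulcea.intro)
  fix i
  show "markov_step P \<mu> i \<in> measurable (PiM {0..<i} (\<lambda>_. S)) (subprob_algebra S)"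
  proof (cases i)
    case 0
    with \<mu> show ?thesis
      by (auto simp: markov_step_def[abs_def] space_prob_algebra space_subprob_algebra
               intro!: measurable_const prob_space_imp_subprob_space)
  next
    case (Suc m)
    have "(\<lambda>\<omega>. P (\<omega> m)) \<in> measurable (PiM {0..<Suc m} (\<lambda>_. S)) (subprob_algebra S)"
      by (rule measurable_compose[OF _ measurable_prob_algebraD[OF P]])
         (rule measurable_component_singleton, simp)
    with Suc show ?thesis
      by (simp add: markov_step_def[abs_def])
  qed
next
  fix i and x :: "nat \<Rightarrow> 'a"
  assume x: "x \<in> space (PiM {0..<i} (\<lambda>_. S))"
  show "prob_space (markov_step P \<mu> i x)"
  proof (cases i)
    case 0
    with \<mu> show ?thesis
      by (simp add: markov_step_def space_prob_algebra)
  next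
    case (Suc m)
    with x have "x m \<in> space S"
      by (auto simp: space_PiM PiE_iff)
    from measurable_space[OF P this] Suc show ?thesis
      by (simp add: markov_step_def space_prob_algebra)
  qed
qed

lemma sets_markov_law:
  assumes "P \<in> measurable S (prob_algebra S)" "\<mu> \<in> space (prob_algebra S)"
  shows "sets (markov_law S P \<mu>) = sets (path_space S)"
proof -
  interpret Ionescu_Tulcea "markov_step P \<mu>" "\<lambda>_. S"
    using assms by (rule Ionescu_Tulcea_markov_step)
  show ?thesis
    by (simp add: markov_law_def path_space_def)
qed

lemma distr_markov_law:
  assumes "P \<in> measurable S (prob_algebra S)" "\<mu> \<in> space (prob_algebra S)"
  shows "distr (markov_law S P \<mu>) (PiM {0..<n} (\<lambda>_. S)) (\<lambda>\<omega>. restrict \<omega> {0..<n}) =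
    Ionescu_Tulcea.C (markov_step P \<mu>) (\<lambda>_. S) 0 n (\<lambda>_. undefined)"
proof -
  interpret Ionescu_Tulcea "markov_step P \<mu>" "\<lambda>_. S"
    using assms by (rule Ionescu_Tulcea_markov_step)
  have "distr (markov_law S P \<mu>) (PiM {0..<n} (\<lambda>_. S)) (\<lambda>\<omega>. restrict \<omega> {0..<n}) = CI {0..<n}"
    unfolding markov_law_def by (rule distr_lim) simp
  also have "\<dots> = C 0 n (\<lambda>_. undefined)"
  proof (rule measure_eqI)
    fix X assume "X \<in> sets (CI {0..<n})"
    then have X: "X \<in> sets (PiM {0..<n} (\<lambda>_. S))"
      by (simp add: CI_def)
    with emeasure_CI[of "{0..<n}" n X]
    show "emeasure (CI {0..<n}) X = emeasure (C 0 n (\<lambda>_. undefined)) X"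
      using sets.sets_into_space[OF X] by (simp add: prod_emb_id space_PiM)
  qed (simp add: CI_def sets_C)
  finally show ?thesis .
qed

lemma prob_space_markov_law:
  assumes "P \<in> measurable S (prob_algebra S)" "\<mu> \<in> space (prob_algebra S)"
  shows "prob_space (markov_law S P \<mu>)"
proof -
  interpret Ionescu_Tulcea "markov_step P \<mu>" "\<lambda>_. S"
    using assms by (rule Ionescu_Tulcea_markov_step)
  have "prob_space (distr (markov_law S P \<mu>) (PiM {0..<0} (\<lambda>_. S)) (\<lambda>\<omega>. restrict \<omega> {0..<0}))"
    unfolding distr_markov_law[OF assms] by (rule prob_space_C) simp
  then show ?thesis
    by (rule prob_space_distrD[rotated])
       (simp add: measurable_cong_sets[OF sets_markov_law[OF assms] refl] path_space_def
             measurable_restrict_subset)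
qed

end

theory Submission
  imports Defs
begin

text \<open>
  Take \<open>I\<close> to be the set of states from which the Streett condition holds almost surely. The
  condition does not depend on the first state, so \<open>I\<close> is absorbing and carries \<open>\<mu>\<close>. Take \<open>J i\<close>
  to be the states of \<open>I - A i\<close> from which \<open>A i\<close> is reached again with probability at most 1/2.
  Put \<open>D = B i \<union> J i \<union> I\<^sup>c\<close> and let \<open>w s\<close> be the probability of never visiting \<open>A i \<union> D\<close> from \<open>s\<close>.
  Outside \<open>A i \<union> D\<close> the set \<open>A i\<close> is reached with probability above 1/2, so \<open>w \<le> 1/2\<close> everywhere.
  By the Markov property at time \<open>n\<close>, \<open>w s\<close> is at most 1/2 times the probability of avoiding
  \<open>A i \<union> D\<close> before time \<open>n\<close>; letting \<open>n\<close> tend to infinity gives \<open>w \<le> w/2\<close>, hence \<open>w = 0\<close>. So a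
  path avoiding \<open>D\<close> almost surely visits \<open>A i\<close> infinitely often, but \<open>B i\<close> never, which is
  impossible from \<open>I\<close>.
\<close>

section \<open>First-step decomposition of the path law\<close>

locale markov_kernel =
  fixes S :: "'a measure" and P :: "'a \<Rightarrow> 'a measure"
  assumes kernel [measurable]: "P \<in> measurable S (prob_algebra S)"
begin

lemma kernel_subprob [measurable]: "P \<in> measurable S (subprob_algebra S)"
  using kernel by (rule measurable_prob_algebraD)

lemma kernel_in_prob_algebra: "s \<in> space S \<Longrightarrow> P s \<in> space (prob_algebra S)"
  using kernel by (rule measurable_space)

lemma return_in_prob_algebra: "s \<in> space S \<Longrightarrow> return S s \<in> space (prob_algebra S)"
  by (simp add: space_prob_algebra prob_space_return)

abbreviation paths :: "(nat \<Rightarrow> 'a) measure" where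
  "paths \<equiv> \<Pi>\<^sub>M n\<in>UNIV. S"

abbreviation law :: "'a \<Rightarrow> (nat \<Rightarrow> 'a) measure" where
  "law s \<equiv> markov_law S P (return S s)"

lemma sets_law:
  "\<mu> \<in> space (prob_algebra S) \<Longrightarrow> sets (markov_law S P \<mu>) = sets paths"
  using sets_markov_law[OF kernel] by (simp add: path_space_def)

text \<open>The expectation of \<open>\<Prod>i\<le>n. f i (\<Phi> i)\<close> for the chain started at \<open>s\<close>, expanded from the first
  coordinate, whereas the Ionescu-Tulcea construction expands it from the last one.\<close>

primrec cyl :: "nat \<Rightarrow> (nat \<Rightarrow> 'a \<Rightarrow> ennreal) \<Rightarrow> 'a \<Rightarrow> ennreal" where
  "cyl 0 f s = f 0 s"
| "cyl (Suc n) f s = f 0 s * (\<integral>\<^sup>+y. cyl n (\<lambda>i. f (Suc i)) y \<partial>P s)"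

lemma measurable_cyl [measurable]:
  assumes "\<And>i. f i \<in> borel_measurable S"
  shows "cyl n f \<in> borel_measurable S"
  using assms
proof (induction n arbitrary: f)
  case 0
  have "cyl 0 f = f 0" by (simp add: fun_eq_iff)
  with 0 show ?case by simp
next
  case (Suc n)
  note [measurable] = Suc
  have "cyl (Suc n) f = (\<lambda>s. f 0 s * (\<integral>\<^sup>+y. cyl n (\<lambda>i. f (Suc i)) y \<partial>P s))"
    by (simp add: fun_eq_iff)
  then show ?case by simp
qed

text \<open>Reconciles the two expansions: \<open>cyl\<close> peels off the first coordinate, the
  Ionescu-Tulcea construction the last. Integrating out the last coordinate only changes the factor
  at \<open>n\<close>, and this passes through the outer integrals.\<close>

lemma cyl_Suc_absorb:
  "s \<in> space S \<Longrightarrow> cyl (Suc n) f s = cyl n (f(n := \<lambda>s. f n s * (\<integral>\<^sup>+y. f (Suc n) y \<partial>P s))) s"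
proof (induction n arbitrary: f s)
  case (Suc n)
  have sp: "space (P s) = space S"
    using Suc.prems by (rule subprob_measurableD(1)[OF kernel_subprob])
  have "cyl (Suc (Suc n)) f s = f 0 s * (\<integral>\<^sup>+y. cyl (Suc n) (\<lambda>i. f (Suc i)) y \<partial>P s)"
    by simp
  \<comment> \<open>Updating at \<open>Suc n\<close> and then shifting equals shifting and then
    updating at \<open>n\<close>, which is the form given by the induction hypothesis for the
    shifted factors.\<close>
  also have "(\<integral>\<^sup>+y. cyl (Suc n) (\<lambda>i. f (Suc i)) y \<partial>P s) =
      (\<integral>\<^sup>+y. cyl n (\<lambda>i. (f(Suc n := \<lambda>s. f (Suc n) s * (\<integral>\<^sup>+y. f (Suc (Suc n)) y \<partial>P s))) (Suc i)) y \<partial>P s)"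
  proof (intro nn_integral_cong)
    fix y assume "y \<in> space (P s)"
    then have "y \<in> space S" using sp by simp
    then show "cyl (Suc n) (\<lambda>i. f (Suc i)) y =
      cyl n (\<lambda>i. (f(Suc n := \<lambda>s. f (Suc n) s * (\<integral>\<^sup>+y. f (Suc (Suc n)) y \<partial>P s))) (Suc i)) y"
      by (subst Suc.IH) (auto intro!: arg_cong[where f="\<lambda>g. cyl n g y"])
  qed
  finally show ?case by simp
qed simp

section \<open>Integrals of products of finitely many coordinate functions\<close>

lemma nn_integral_markov_law_restrict:
  assumes \<mu>: "\<mu> \<in> space (prob_algebra S)"
    and h: "h \<in> borel_measurable (PiM {0..<n} (\<lambda>_. S))"
  shows "(\<integral>\<^sup>+\<omega>. h (restrict \<omega> {0..<n}) \<partial>markov_law S P \<mu>) =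
    (\<integral>\<^sup>+x. h x \<partial>Ionescu_Tulcea.C (markov_step P \<mu>) (\<lambda>_. S) 0 n (\<lambda>_. undefined))"
proof -
  have "(\<lambda>\<omega>. restrict \<omega> {0..<n}) \<in> measurable (markov_law S P \<mu>) (PiM {0..<n} (\<lambda>_. S))"
    unfolding measurable_cong_sets[OF sets_law[OF \<mu>] refl]
    by (rule measurable_restrict_subset) simp
  from nn_integral_distr[OF this, of h] h show ?thesis
    unfolding distr_markov_law[OF kernel \<mu>, symmetric] by simp
qed

text \<open>Stage \<open>Suc (Suc n)\<close> of the construction is stage \<open>Suc n\<close>
  followed by one kernel step that depends on coordinate \<open>n\<close> alone, so the last factor
  can be integrated out conditionally.\<close>

lemma nn_integral_markov_law_Suc:
  assumes \<mu>: "\<mu> \<in> space (prob_algebra S)"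
    and f: "\<And>i. f i \<in> borel_measurable S"
  shows "(\<integral>\<^sup>+\<omega>. (\<Prod>i\<le>Suc n. f i (\<omega> i)) \<partial>markov_law S P \<mu>) =
    (\<integral>\<^sup>+\<omega>. (\<Prod>i\<le>n. f i (\<omega> i)) * (\<integral>\<^sup>+y. f (Suc n) y \<partial>P (\<omega> n)) \<partial>markov_law S P \<mu>)"
proof -
  interpret IT: Ionescu_Tulcea "markov_step P \<mu>" "\<lambda>_. S"
    using kernel \<mu> by (rule Ionescu_Tulcea_markov_step)
  note [measurable] = f
  note [measurable_cong] = sets_law[OF \<mu>]
  let ?C = "\<lambda>m. IT.C 0 m (\<lambda>_. undefined)"
  have und: "(\<lambda>_. undefined) \<in> space (PiM {0..<0::nat} (\<lambda>_. S))"
    by (simp add: space_PiM)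
  note transfer = nn_integral_markov_law_restrict[OF \<mu>]
  have meas: "(\<lambda>\<omega>. \<Prod>i\<le>n. f i (\<omega> i)) \<in> borel_measurable (PiM {0..<m} (\<lambda>_. S))" if "n < m" for n m
    using that
    by (intro borel_measurable_prod_ennreal measurable_compose[OF _ f] measurable_component_singleton) auto
  have meas_n [measurable]: "(\<lambda>\<omega>. \<omega> n) \<in> measurable (PiM {0..<Suc n} (\<lambda>_. S)) S"
    by (rule measurable_component_singleton) simp
  \<comment> \<open>The indices up to \<open>Suc n\<close> fill \<open>{0..<Suc (Suc n)}\<close>, so
    restricting the path leaves the product unchanged and makes \<open>transfer\<close>
    applicable.\<close>
  have "(\<integral>\<^sup>+\<omega>. (\<Prod>i\<le>Suc n. f i (\<omega> i)) \<partial>markov_law S P \<mu>) =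
      (\<integral>\<^sup>+\<omega>. (\<Prod>i\<le>Suc n. f i (restrict \<omega> {0..<Suc (Suc n)} i)) \<partial>markov_law S P \<mu>)"
    by (intro nn_integral_cong prod.cong) auto
  also have "\<dots> = (\<integral>\<^sup>+x. (\<Prod>i\<le>Suc n. f i (x i)) \<partial>?C (Suc (Suc n)))"
    by (rule transfer[OF meas]) simp
  also have "\<dots> = (\<integral>\<^sup>+x. \<integral>\<^sup>+y. (\<Prod>i\<le>Suc n. f i (y i)) \<partial>IT.eP (Suc n) x \<partial>?C (Suc n))"
    unfolding IT.C.simps(2)[of 0 "Suc n"] add_0
  proof (rule nn_integral_bind)
    show "(\<lambda>y. \<Prod>i\<le>Suc n. f i (y i)) \<in> borel_measurable (PiM {0..<Suc (Suc n)} (\<lambda>_. S))"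
      by (rule meas) simp
    have "sets (?C (Suc n)) = sets (PiM {0..<Suc n} (\<lambda>_. S))"
      using IT.sets_C[OF und, of "Suc n"] by simp
    then show "IT.eP (Suc n) \<in> measurable (?C (Suc n)) (subprob_algebra (PiM {0..<Suc (Suc n)} (\<lambda>_. S)))"
      using IT.measurable_eP[of "Suc n"] by (simp cong: measurable_cong_sets)
  qed
  also have "\<dots> = (\<integral>\<^sup>+x. (\<Prod>i\<le>n. f i (x i)) * (\<integral>\<^sup>+y. f (Suc n) y \<partial>P (x n)) \<partial>?C (Suc n))"
  proof (rule nn_integral_cong)
    fix x assume "x \<in> space (?C (Suc n))"
    then have x: "x \<in> space (PiM {0..<Suc n} (\<lambda>_. S))"
      using IT.space_C[OF und, of "Suc n"] by simp
    then have xn: "x n \<in> space S"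
      by (auto simp: space_PiM PiE_iff)
    have Pxn: "sets (P (x n)) = sets S"
      by (rule subprob_measurableD(2)[OF kernel_subprob xn])
    have "(\<integral>\<^sup>+y. (\<Prod>i\<le>Suc n. f i (y i)) \<partial>IT.eP (Suc n) x) =
        (\<integral>\<^sup>+y. (\<Prod>i\<le>Suc n. f i ((x(Suc n := y)) i)) \<partial>markov_step P \<mu> (Suc n) x)"
      using x by (rule IT.nn_integral_eP) (rule meas, simp)
    also have "\<dots> = (\<integral>\<^sup>+y. (\<Prod>i\<le>n. f i (x i)) * f (Suc n) y \<partial>P (x n))"
      by (simp add: markov_step_def)
    also have "\<dots> = (\<Prod>i\<le>n. f i (x i)) * (\<integral>\<^sup>+y. f (Suc n) y \<partial>P (x n))"
      using f by (intro nn_integral_cmult) (simp cong: measurable_cong_sets add: Pxn)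
    finally show "(\<integral>\<^sup>+y. (\<Prod>i\<le>Suc n. f i (y i)) \<partial>IT.eP (Suc n) x) = \<dots>" .
  qed
  also have "\<dots> = (\<integral>\<^sup>+\<omega>. (\<Prod>i\<le>n. f i (restrict \<omega> {0..<Suc n} i)) *
      (\<integral>\<^sup>+y. f (Suc n) y \<partial>P (restrict \<omega> {0..<Suc n} n)) \<partial>markov_law S P \<mu>)"
  proof (rule transfer[symmetric])
    show "(\<lambda>x. (\<Prod>i\<le>n. f i (x i)) * (\<integral>\<^sup>+y. f (Suc n) y \<partial>P (x n)))
        \<in> borel_measurable (PiM {0..<Suc n} (\<lambda>_. S))"
      by (intro borel_measurable_times_ennreal meas) simp_all
  qed
  also have "\<dots> = (\<integral>\<^sup>+\<omega>. (\<Prod>i\<le>n. f i (\<omega> i)) * (\<integral>\<^sup>+y. f (Suc n) y \<partial>P (\<omega> n)) \<partial>markov_law S P \<mu>)"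
    by (intro nn_integral_cong arg_cong2[where f="(*)"] prod.cong) auto
  finally show ?thesis .
qed

lemma nn_integral_markov_law_0:
  assumes \<mu>: "\<mu> \<in> space (prob_algebra S)" and f: "f \<in> borel_measurable S"
  shows "(\<integral>\<^sup>+\<omega>. f (\<omega> 0) \<partial>markov_law S P \<mu>) = (\<integral>\<^sup>+s. f s \<partial>\<mu>)"
proof -
  interpret IT: Ionescu_Tulcea "markov_step P \<mu>" "\<lambda>_. S"
    using kernel \<mu> by (rule Ionescu_Tulcea_markov_step)
  have und: "(\<lambda>_. undefined) \<in> space (PiM {0..<0::nat} (\<lambda>_. S))"
    by (simp add: space_PiM)
  have m: "(\<lambda>x. f (x 0)) \<in> borel_measurable (PiM {0..<Suc 0} (\<lambda>_. S))"
    by (rule measurable_compose[OF _ f]) (rule measurable_component_singleton, simp)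
  have "(\<integral>\<^sup>+\<omega>. f (\<omega> 0) \<partial>markov_law S P \<mu>) = 
      (\<integral>\<^sup>+\<omega>. f (restrict \<omega> {0..<Suc 0} 0) \<partial>markov_law S P \<mu>)"
    by simp
  also have "\<dots> = (\<integral>\<^sup>+x. f (x 0) \<partial>IT.C 0 (Suc 0) (\<lambda>_. undefined))"
    by (rule nn_integral_markov_law_restrict[OF \<mu> m])
  also have "IT.C 0 (Suc 0) (\<lambda>_. undefined) = IT.eP 0 (\<lambda>_. undefined)"
    using bind_return[OF IT.measurable_eP und] by simp
  also have "(\<integral>\<^sup>+x. f (x 0) \<partial>IT.eP 0 (\<lambda>_. undefined)) = (\<integral>\<^sup>+s. f s \<partial>\<mu>)"
    unfolding IT.nn_integral_eP[OF und m] by (simp add: markov_step_def)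
  finally show ?thesis .
qed

text \<open>Induction removes the last factor on both sides: its conditional expectation is merged
  into the factor at \<open>n\<close>, by \<open>nn_integral_markov_law_Suc\<close> for the path law
  and by \<open>cyl_Suc_absorb\<close> for \<open>cyl\<close>.\<close>

lemma nn_integral_markov_law_cyl:
  assumes \<mu>: "\<mu> \<in> space (prob_algebra S)"
    and "\<And>i. f i \<in> borel_measurable S"
  shows "(\<integral>\<^sup>+\<omega>. (\<Prod>i\<le>n. f i (\<omega> i)) \<partial>markov_law S P \<mu>) = (\<integral>\<^sup>+s. cyl n f s \<partial>\<mu>)"
  using assms(2)
proof (induction n arbitrary: f)
  case 0
  then show ?case using nn_integral_markov_law_0[OF \<mu>] by simp
next
  case (Suc n)
  note [measurable] = Suc.prems
  let ?f = "f(n := \<lambda>s. f n s * (\<integral>\<^sup>+y. f (Suc n) y \<partial>P s))"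
  have [measurable]: "?f i \<in> borel_measurable S" for i by simp
  have "(\<integral>\<^sup>+\<omega>. (\<Prod>i\<le>Suc n. f i (\<omega> i)) \<partial>markov_law S P \<mu>) =
      (\<integral>\<^sup>+\<omega>. (\<Prod>i\<le>n. f i (\<omega> i)) * (\<integral>\<^sup>+y. f (Suc n) y \<partial>P (\<omega> n)) \<partial>markov_law S P \<mu>)"
    by (rule nn_integral_markov_law_Suc[OF \<mu> Suc.prems])
  also have "\<dots> = (\<integral>\<^sup>+\<omega>. (\<Prod>i\<le>n. ?f i (\<omega> i)) \<partial>markov_law S P \<mu>)"
  proof (rule nn_integral_cong)
    fix \<omega> :: "nat \<Rightarrow> 'a"
    have "(\<Prod>i<n. ?f i (\<omega> i)) = (\<Prod>i<n. f i (\<omega> i))"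
      by (intro prod.cong) auto
    then show "(\<Prod>i\<le>n. f i (\<omega> i)) * (\<integral>\<^sup>+y. f (Suc n) y \<partial>P (\<omega> n)) = (\<Prod>i\<le>n. ?f i (\<omega> i))"
      by (simp add: lessThan_Suc_atMost[symmetric] mult.assoc)
  qed
  also have "\<dots> = (\<integral>\<^sup>+s. cyl n ?f s \<partial>\<mu>)"
    by (rule Suc.IH) measurable
  also have "\<dots> = (\<integral>\<^sup>+s. cyl (Suc n) f s \<partial>\<mu>)"
    using \<mu> by (intro nn_integral_cong cyl_Suc_absorb[symmetric])
      (auto simp: space_prob_algebra dest: sets_eq_imp_space_eq)
  finally show ?case .
qed

section \<open>Cylinder events and dependence on the initial state\<close>

lemma cylinder_set:
  assumes "finite J" "\<And>i. i \<in> J \<Longrightarrow> E i \<in> sets S"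
  obtains X n where "\<forall>i. X i \<in> sets S"
    "prod_emb UNIV (\<lambda>_. S) J (Pi\<^sub>E J E) = {\<omega> \<in> space paths. \<forall>i\<le>Suc n. \<omega> i \<in> X i}"
proof
  \<comment> \<open>Padding with \<open>space S\<close> turns a finite index set into an initial
    segment. The bound \<open>Suc n\<close> leaves a coordinate over when the first one is split
    off. For empty \<open>J\<close> the value of \<open>Max J\<close> is arbitrary but harmless,
    every factor then being \<open>space S\<close>.\<close>
  show "\<forall>i. (if i \<in> J then E i else space S) \<in> sets S"
    using assms by simp
  have "i \<le> Suc (Max J)" if "i \<in> J" for i
    using that assms(1) by (simp add: le_SucI)
  then show "prod_emb UNIV (\<lambda>_. S) J (Pi\<^sub>E J E) =
      {\<omega> \<in> space paths. \<forall>i\<le>Suc (Max J). \<omega> i \<in> (if i \<in> J then E i else space S)}"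
    by (auto simp: prod_emb_def space_PiM PiE_iff)
qed

lemma emeasure_markov_law_cylinder:
  assumes \<mu>: "\<mu> \<in> space (prob_algebra S)"
    and X: "\<And>i. X i \<in> sets S"
  shows "emeasure (markov_law S P \<mu>) {\<omega> \<in> space paths. \<forall>i\<le>n. \<omega> i \<in> X i} =
    (\<integral>\<^sup>+s. cyl n (\<lambda>i. indicator (X i)) s \<partial>\<mu>)"
proof -
  note [measurable] = X
  note [measurable_cong] = sets_law[OF \<mu>]
  have "emeasure (markov_law S P \<mu>) {\<omega> \<in> space paths. \<forall>i\<le>n. \<omega> i \<in> X i} =
      (\<integral>\<^sup>+\<omega>. indicator {\<omega> \<in> space paths. \<forall>i\<le>n. \<omega> i \<in> X i} \<omega> \<partial>markov_law S P \<mu>)"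
    by (rule nn_integral_indicator[symmetric]) measurable
  also have "\<dots> = (\<integral>\<^sup>+\<omega>. (\<Prod>i\<le>n. indicator (X i) (\<omega> i)) \<partial>markov_law S P \<mu>)"
  proof (rule nn_integral_cong)
    fix \<omega> assume "\<omega> \<in> space (markov_law S P \<mu>)"
    then have "\<omega> \<in> space paths" using sets_eq_imp_space_eq[OF sets_law[OF \<mu>]] by simp
    then show "indicator {\<omega> \<in> space paths. \<forall>i\<le>n. \<omega> i \<in> X i} \<omega> =
        (\<Prod>i\<le>n. indicator (X i) (\<omega> i) :: ennreal)"
      by (cases "\<forall>i\<le>n. \<omega> i \<in> X i") (auto simp: indicator_eq_0_iff)
  qed
  also have "\<dots> = (\<integral>\<^sup>+s. cyl n (\<lambda>i. indicator (X i)) s \<partial>\<mu>)"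
    by (rule nn_integral_markov_law_cyl[OF \<mu>]) measurable
  finally show ?thesis .
qed

lemma emeasure_law_cylinder:
  assumes s: "s \<in> space S" and X[measurable]: "\<And>i. X i \<in> sets S"
  shows "emeasure (law s) {\<omega> \<in> space paths. \<forall>i\<le>n. \<omega> i \<in> X i} = cyl n (\<lambda>i. indicator (X i)) s"
  using s by (subst emeasure_markov_law_cylinder[OF return_in_prob_algebra X]) (auto intro!: nn_integral_return)

text \<open>Measurability in the starting state need only be tested on an intersection-stable
  generator; on cylinders the probability is the explicit measurable function
  \<open>cyl\<close>.\<close>

lemma measurable_law [measurable]: "law \<in> measurable S (prob_algebra paths)"
proof (rule measurable_prob_algebra_generated[OF sets_PiM Int_stable_prod_algebra prod_algebra_sets_into_space])
  fix s assume "s \<in> space S"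
  then show "prob_space (law s)" "sets (law s) = sets paths"
    by (simp_all add: return_in_prob_algebra prob_space_markov_law[OF kernel] sets_law)
next
  fix E assume "E \<in> prod_algebra UNIV (\<lambda>_::nat. S)"
  then obtain J F where "E = prod_emb UNIV (\<lambda>_. S) J (Pi\<^sub>E J F)"
    and J: "finite J" "\<And>i. i \<in> J \<Longrightarrow> F i \<in> sets S"
    by (rule prod_algebraE) blast
  moreover from J obtain X n where "\<forall>i. X i \<in> sets S"
    and "prod_emb UNIV (\<lambda>_. S) J (Pi\<^sub>E J F) = {\<omega> \<in> space paths. \<forall>i\<le>Suc n. \<omega> i \<in> X i}"
    by (rule cylinder_set)
  ultimately have [measurable]: "\<And>i. X i \<in> sets S"
    and E: "E = {\<omega> \<in> space paths. \<forall>i\<le>Suc n. \<omega> i \<in> X i}"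
    by simp_all
  show "(\<lambda>s. emeasure (law s) E) \<in> borel_measurable S"
    unfolding E by (subst measurable_cong[OF emeasure_law_cylinder]) measurable
qed

lemma measurable_law_subprob [measurable]: "law \<in> measurable S (subprob_algebra paths)"
  using measurable_law by (rule measurable_prob_algebraD)

text \<open>Reduces an arbitrary initial distribution to point starts. Cylinders determine a finite
  measure on path space, and there both sides integrate \<open>cyl\<close> against
  \<open>\<mu>\<close>.\<close>

lemma markov_law_eq_bind:
  assumes \<mu>: "\<mu> \<in> space (prob_algebra S)"
  shows "markov_law S P \<mu> = \<mu> \<bind> law"
proof (rule measure_eqI_PiM_infinite)
  show "sets (markov_law S P \<mu>) = sets paths" "sets (\<mu> \<bind> law) = sets paths"
    using \<mu> by (simp_all add: sets_law sets_bind'[OF \<mu> measurable_law])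
  show "finite_measure (markov_law S P \<mu>)"
    using prob_space_markov_law[OF kernel \<mu>] by (simp add: prob_space.finite_measure)
next
  fix E and J :: "nat set" assume "finite J" "\<And>i. i \<in> J \<Longrightarrow> E i \<in> sets S"
  then obtain X n where "\<forall>i. X i \<in> sets S"
    and E: "prod_emb UNIV (\<lambda>_. S) J (Pi\<^sub>E J E) = {\<omega> \<in> space paths. \<forall>i\<le>Suc n. \<omega> i \<in> X i}"
    by (rule cylinder_set)
  then have X[measurable]: "\<And>i. X i \<in> sets S" by simp
  show "emeasure (markov_law S P \<mu>) (prod_emb UNIV (\<lambda>_. S) J (Pi\<^sub>E J E)) =
      emeasure (\<mu> \<bind> law) (prod_emb UNIV (\<lambda>_. S) J (Pi\<^sub>E J E))"
    unfolding E emeasure_markov_law_cylinder[OF \<mu> X]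
  proof (subst emeasure_bind_prob_algebra[OF \<mu> measurable_law])
    show "(\<integral>\<^sup>+s. cyl (Suc n) (\<lambda>i. indicator (X i)) s \<partial>\<mu>) =
        (\<integral>\<^sup>+s. emeasure (law s) {\<omega> \<in> space paths. \<forall>i\<le>Suc n. \<omega> i \<in> X i} \<partial>\<mu>)"
      using \<mu> by (intro nn_integral_cong emeasure_law_cylinder[symmetric])
        (auto simp: space_prob_algebra dest: sets_eq_imp_space_eq)
  qed measurable
qed

text \<open>The Markov property at time 1: \<open>P s \<bind> law\<close> is the law of the path
  after its first step, and \<open>case_nat s\<close> puts the start back in front. On cylinders
  this is the recursion equation of \<open>cyl\<close>.\<close>

lemma law_eq_distr_Cons:
  assumes s: "s \<in> space S"
  shows "law s = distr (P s \<bind> law) paths (case_nat s)"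
proof (rule measure_eqI_PiM_infinite)
  show "sets (law s) = sets paths" "sets (distr (P s \<bind> law) paths (case_nat s)) = sets paths"
    using s by (simp_all add: sets_law return_in_prob_algebra)
  show "finite_measure (law s)"
    using prob_space_markov_law[OF kernel return_in_prob_algebra[OF s]]
    by (simp add: prob_space.finite_measure)
next
  note Ps = kernel_in_prob_algebra[OF s]
  have [measurable_cong]: "sets (P s \<bind> law) = sets paths"
    by (rule sets_bind'[OF Ps measurable_law])
  have [measurable]: "case_nat s \<in> measurable paths paths"
    using s by measurable
  fix E and J :: "nat set" assume "finite J" "\<And>i. i \<in> J \<Longrightarrow> E i \<in> sets S"
  then obtain X n where "\<forall>i. X i \<in> sets S"
    and E: "prod_emb UNIV (\<lambda>_. S) J (Pi\<^sub>E J E) = {\<omega> \<in> space paths. \<forall>i\<le>Suc n. \<omega> i \<in> X i}"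
    by (rule cylinder_set)
  then have X[measurable]: "\<And>i. X i \<in> sets S" by simp
  let ?C = "{\<omega> \<in> space paths. \<forall>i\<le>n. \<omega> i \<in> X (Suc i)}"
  have split: "(\<forall>i\<le>Suc n. case_nat s \<omega> i \<in> X i) \<longleftrightarrow> s \<in> X 0 \<and> (\<forall>i\<le>n. \<omega> i \<in> X (Suc i))" for \<omega>
    unfolding less_Suc_eq_le[symmetric] All_less_Suc2 by simp
  have vim: "case_nat s -` {\<omega> \<in> space paths. \<forall>i\<le>Suc n. \<omega> i \<in> X i} \<inter> space (P s \<bind> law) =
      (if s \<in> X 0 then ?C else {})"
    using measurable_space[of "case_nat s" paths paths]
    by (auto simp: sets_eq_imp_space_eq[OF sets_bind'[OF Ps measurable_law]] split)
  have "emeasure (distr (P s \<bind> law) paths (case_nat s)) {\<omega> \<in> space paths. \<forall>i\<le>Suc n. \<omega> i \<in> X i} =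
      emeasure (P s \<bind> law) (if s \<in> X 0 then ?C else {})"
    unfolding vim[symmetric] by (rule emeasure_distr) measurable
  also have "\<dots> = indicator (X 0) s * emeasure (P s \<bind> law) ?C"
    by simp
  also have "emeasure (P s \<bind> law) ?C = (\<integral>\<^sup>+y. emeasure (law y) ?C \<partial>P s)"
    by (rule emeasure_bind_prob_algebra[OF Ps measurable_law]) measurable
  also have "\<dots> = (\<integral>\<^sup>+y. cyl n (\<lambda>i. indicator (X (Suc i))) y \<partial>P s)"
    using Ps by (intro nn_integral_cong emeasure_law_cylinder)
      (auto simp: space_prob_algebra dest: sets_eq_imp_space_eq)
  finally show "emeasure (law s) (prod_emb UNIV (\<lambda>_. S) J (Pi\<^sub>E J E)) =
      emeasure (distr (P s \<bind> law) paths (case_nat s)) (prod_emb UNIV (\<lambda>_. S) J (Pi\<^sub>E J E))"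
    unfolding E by (simp add: emeasure_law_cylinder[OF s X])
qed

section \<open>First-step rules for probabilities and almost sure statements\<close>

lemma space_paths_law:
  "\<mu> \<in> space (prob_algebra S) \<Longrightarrow> space (markov_law S P \<mu>) = space paths"
  by (rule sets_eq_imp_space_eq[OF sets_law])

lemma space_kernel: "s \<in> space S \<Longrightarrow> space (P s) = space S"
  by (rule subprob_measurableD(1)[OF kernel_subprob])

lemma AE_markov_law_iff:
  assumes "\<mu> \<in> space (prob_algebra S)" "Measurable.pred paths Q"
  shows "(AE \<omega> in markov_law S P \<mu>. Q \<omega>) \<longleftrightarrow> (AE s in \<mu>. AE \<omega> in law s. Q \<omega>)"
  unfolding markov_law_eq_bind[OF assms(1)]
proof (rule AE_bind[OF _ assms(2)])
  have "sets \<mu> = sets S" using assms(1) by (simp add: space_prob_algebra)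
  then show "law \<in> measurable \<mu> (subprob_algebra paths)"
    using measurable_law_subprob by (simp cong: measurable_cong_sets)
qed

lemma measurable_case_nat_paths: "s \<in> space S \<Longrightarrow> case_nat s \<in> measurable paths paths"
  by measurable

lemma AE_law_Cons:
  assumes s: "s \<in> space S" and Q[measurable]: "Measurable.pred paths Q"
  shows "(AE \<omega> in law s. Q \<omega>) \<longleftrightarrow> (AE y in P s. AE \<omega> in law y. Q (case_nat s \<omega>))"
proof -
  note Ps = kernel_in_prob_algebra[OF s]
  have [measurable_cong]: "sets (P s \<bind> law) = sets paths"
    by (rule sets_bind'[OF Ps measurable_law])
  have sets_Ps: "sets (P s) = sets S"
    using Ps by (simp add: space_prob_algebra)
  note [measurable] = measurable_case_nat_paths[OF s]
  have "(AE \<omega> in law s. Q \<omega>) \<longleftrightarrow> (AE \<omega> in P s \<bind> law. Q (case_nat s \<omega>))"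
    by (subst law_eq_distr_Cons[OF s], rule AE_distr_iff) measurable
  also have "\<dots> \<longleftrightarrow> (AE y in P s. AE \<omega> in law y. Q (case_nat s \<omega>))"
  proof (rule AE_bind)
    show "law \<in> measurable (P s) (subprob_algebra paths)"
      using measurable_law_subprob sets_Ps by (simp cong: measurable_cong_sets)
  qed measurable
  finally show ?thesis .
qed

lemma emeasure_law_Cons:
  assumes s: "s \<in> space S" and Q[measurable]: "Measurable.pred paths Q"
  shows "emeasure (law s) {\<omega> \<in> space paths. Q \<omega>} =
    (\<integral>\<^sup>+y. emeasure (law y) {\<omega> \<in> space paths. Q (case_nat s \<omega>)} \<partial>P s)"
proof -
  note Ps = kernel_in_prob_algebra[OF s]
  have sets_bind [measurable_cong]: "sets (P s \<bind> law) = sets paths"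
    by (rule sets_bind'[OF Ps measurable_law])
  note [measurable] = measurable_case_nat_paths[OF s]
  have "emeasure (law s) {\<omega> \<in> space paths. Q \<omega>} =
      emeasure (P s \<bind> law) (case_nat s -` {\<omega> \<in> space paths. Q \<omega>} \<inter> space (P s \<bind> law))"
    by (subst law_eq_distr_Cons[OF s], rule emeasure_distr) measurable
  also have "case_nat s -` {\<omega> \<in> space paths. Q \<omega>} \<inter> space (P s \<bind> law) =
      {\<omega> \<in> space paths. Q (case_nat s \<omega>)}"
    using measurable_space[OF measurable_case_nat_paths[OF s]] sets_eq_imp_space_eq[OF sets_bind]
    by auto
  also have "emeasure (P s \<bind> law) \<dots> =
      (\<integral>\<^sup>+y. emeasure (law y) {\<omega> \<in> space paths. Q (case_nat s \<omega>)} \<partial>P s)"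
    by (rule emeasure_bind_prob_algebra[OF Ps measurable_law]) measurable
  finally show ?thesis .
qed

lemma emeasure_Collect_eq_1_iff:
  assumes \<mu>: "\<mu> \<in> space (prob_algebra S)" and [measurable]: "Measurable.pred paths Q"
  shows "emeasure (markov_law S P \<mu>) {\<omega> \<in> space paths. Q \<omega>} = 1 \<longleftrightarrow> (AE \<omega> in markov_law S P \<mu>. Q \<omega>)"
proof -
  interpret prob_space "markov_law S P \<mu>"
    by (rule prob_space_markov_law[OF kernel \<mu>])
  note [measurable_cong] = sets_law[OF \<mu>]
  show ?thesis
    unfolding space_paths_law[OF \<mu>, symmetric] by (rule AE_iff_emeasure_eq_1[symmetric]) measurable
qed

section \<open>Avoiding and visiting sets\<close>

lemma AE_law_start:
  assumes "s \<in> X" "s \<in> space S" and [measurable]: "X \<in> sets S"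
  shows "AE \<omega> in law s. \<omega> 0 \<in> X"
proof (subst AE_law_Cons)
  show "AE y in P s. AE \<omega> in law y. case_nat s \<omega> 0 \<in> X"
    using assms(1) by simp
qed (use assms(2) in measurable)

text \<open>A zero-one effect: avoiding \<open>E\<close> forever means avoiding it before time
  \<open>n\<close> and again from then on, and the second part costs a factor \<open>c\<close>
  however large \<open>n\<close> is.\<close>

lemma emeasure_avoid_eq_0:
  assumes E[measurable]: "E \<in> sets S" and c: "c < 1"
    and le: "\<And>s. s \<in> space S \<Longrightarrow> emeasure (law s) {\<omega> \<in> space paths. \<forall>n. \<omega> n \<notin> E} \<le> c"
    and s: "s \<in> space S"
  shows "emeasure (law s) {\<omega> \<in> space paths. \<forall>n. \<omega> n \<notin> E} = 0"
proof -
  define w where "w s = emeasure (law s) {\<omega> \<in> space paths. \<forall>n. \<omega> n \<notin> E}" for s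
  \<comment> \<open>With the strict bound \<open>i<n\<close>, \<open>v 0 s\<close> is the total mass
    1, so the base case of \<open>w_le\<close> is the assumed bound.\<close>
  define v where "v n s = emeasure (law s) {\<omega> \<in> space paths. \<forall>i<n. \<omega> i \<notin> E}" for n :: nat and s
  have [measurable]: "v n \<in> borel_measurable S" for n
    unfolding v_def by measurable
  have split: "(\<forall>n. case_nat s \<omega> n \<notin> E) \<longleftrightarrow> s \<notin> E \<and> (\<forall>n. \<omega> n \<notin> E)" for s \<omega>
    by (auto split: nat.splits)
  have split_Suc: "(\<forall>i<Suc n. case_nat s \<omega> i \<notin> E) \<longleftrightarrow> s \<notin> E \<and> (\<forall>i<n. \<omega> i \<notin> E)" for s \<omega> n
    unfolding All_less_Suc2 by simp
  \<comment> \<open>First steps suffice in place of the Markov property at time \<open>n\<close>: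
    off \<open>E\<close>, both \<open>w\<close> and \<open>v (Suc n)\<close> are averages under
    \<open>P s\<close> of \<open>w\<close> and \<open>v n\<close>; on \<open>E\<close>,
    \<open>w\<close> vanishes.\<close>
  have w_le: "w s \<le> c * v n s" if "s \<in> space S" for n s
    using that
  proof (induction n arbitrary: s)
    case 0
    interpret prob_space "law s"
      by (rule prob_space_markov_law[OF kernel return_in_prob_algebra[OF 0]])
    show ?case
      using le[OF 0] emeasure_space_1 space_paths_law[OF return_in_prob_algebra[OF 0]]
      by (simp add: w_def v_def)
  next
    case (Suc n)
    show ?case
    proof (cases "s \<in> E")
      case True
      then have "w s = 0"
        unfolding w_def by (subst emeasure_law_Cons[OF Suc.prems]) (simp_all add: split)
      then show ?thesis by simp
    next
      case False
      have "w s = (\<integral>\<^sup>+y. w y \<partial>P s)"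
        using False unfolding w_def by (subst emeasure_law_Cons[OF Suc.prems]) (simp_all add: split)
      also have "\<dots> \<le> (\<integral>\<^sup>+y. c * v n y \<partial>P s)"
        using Suc.IH by (intro nn_integral_mono) (simp add: space_kernel[OF Suc.prems])
      also have "\<dots> = c * (\<integral>\<^sup>+y. v n y \<partial>P s)"
        by (rule nn_integral_cmult)
          (simp add: measurable_cong_sets[OF subprob_measurableD(2)[OF kernel_subprob Suc.prems] refl])
      also have "(\<integral>\<^sup>+y. v n y \<partial>P s) = v (Suc n) s"
        using False unfolding v_def
        by (subst emeasure_law_Cons[OF Suc.prems]) (simp_all only: split_Suc, simp_all)
      finally show ?thesis .
    qed
  qed
  interpret prob_space "law s"
    by (rule prob_space_markov_law[OF kernel return_in_prob_algebra[OF s]])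
  note [measurable_cong] = sets_law[OF return_in_prob_algebra[OF s]]
  have "(\<lambda>n. v n s) \<longlonglongrightarrow> emeasure (law s) (\<Inter>n. {\<omega> \<in> space paths. \<forall>i<n. \<omega> i \<notin> E})"
    unfolding v_def
  proof (rule Lim_emeasure_decseq)
    show "range (\<lambda>n. {\<omega> \<in> space paths. \<forall>i<n. \<omega> i \<notin> E}) \<subseteq> events"
      by (intro image_subsetI) measurable
    show "decseq (\<lambda>n. {\<omega> \<in> space paths. \<forall>i<n. \<omega> i \<notin> E})"
      by (auto simp: decseq_def)
  qed simp
  also have "(\<Inter>n. {\<omega> \<in> space paths. \<forall>i<n. \<omega> i \<notin> E}) = {\<omega> \<in> space paths. \<forall>n. \<omega> n \<notin> E}"
    by auto
  finally have "(\<lambda>n. c * v n s) \<longlonglongrightarrow> c * w s"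
    using c unfolding w_def by (intro ennreal_tendsto_cmult) (auto intro: order.strict_trans)
  then have "w s \<le> c * w s"
    by (rule LIMSEQ_le_const) (auto intro: w_le[OF s])
  \<comment> \<open>Strictness in \<open>ennreal\<close> requires \<open>w s\<close> to be nonzero
    and finite; finiteness holds because \<open>w s\<close> is a probability.\<close>
  moreover have "c * w s < 1 * w s" if "w s \<noteq> 0"
    using that c by (intro ennreal_mult_strict_right_mono) (auto simp: w_def zero_less_iff_neq_zero less_top[symmetric])
  ultimately show ?thesis
    unfolding w_def[symmetric] by (metis mult_1 not_le)
qed

text \<open>A path that avoids \<open>?D\<close> must almost surely keep visiting \<open>A\<close>,
  so the Streett alternative leaves only infinitely many visits to \<open>B\<close>, a subset of
  \<open>?D\<close>. A start outside \<open>I\<close> is in \<open>?D\<close> at once.\<close>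

lemma AE_law_visits:
  assumes meas [measurable]: "A \<in> sets S" "B \<in> sets S" "I \<in> sets S" "J \<in> sets S"
    and streett: "\<And>s. s \<in> I \<Longrightarrow>
      AE \<omega> in law s. (\<exists>n. \<forall>m\<ge>n. \<omega> m \<notin> A) \<or> (\<forall>n. \<exists>m\<ge>n. \<omega> m \<in> B)"
    and J: "\<And>s. s \<in> I - A - J \<Longrightarrow> measure (law s) {\<omega> \<in> space paths. \<exists>n\<ge>1. \<omega> n \<in> A} \<ge> 1 / 2"
    and s: "s \<in> space S"
  shows "AE \<omega> in law s. \<exists>n. \<omega> n \<in> B \<union> J \<union> (space S - I)"
proof -
  let ?D = "B \<union> J \<union> (space S - I)"
  \<comment> \<open>The bound must hold at every state, since the chain may be anywhere at time
    \<open>n\<close>. In \<open>A \<union> ?D\<close> avoidance already fails at time 0; every other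
    state lies in \<open>I - A - J\<close>, where the assumption on \<open>J\<close>
    applies.\<close>
  have avoid_le: "emeasure (law t) {\<omega> \<in> space paths. \<forall>n. \<omega> n \<notin> A \<union> ?D} \<le> ennreal (1 / 2)"
    if t: "t \<in> space S" for t
  proof -
    note rt = return_in_prob_algebra[OF t]
    note [measurable_cong] = sets_law[OF rt]
    interpret prob_space "law t"
      by (rule prob_space_markov_law[OF kernel rt])
    have ev: "{\<omega> \<in> space paths. \<exists>n\<ge>1. \<omega> n \<in> A} \<in> events"
      by measurable
    have sp: "space (law t) = space paths" by (rule space_paths_law[OF rt])
    show ?thesis
    proof (cases "t \<in> A \<union> ?D")
      case True
      have "AE \<omega> in law t. \<omega> 0 \<in> A \<union> ?D"
        by (rule AE_law_start[OF True t]) measurable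
      then have "AE \<omega> in law t. \<not> (\<forall>n. \<omega> n \<notin> A \<union> ?D)"
        by eventually_elim blast
      then have "emeasure (law t) {\<omega> \<in> space (law t). \<forall>n. \<omega> n \<notin> A \<union> ?D} = 0"
        by (rule emeasure_eq_0_AE)
      then show ?thesis by (simp add: sp)
    next
      case False
      have "prob {\<omega> \<in> space paths. \<forall>n. \<omega> n \<notin> A \<union> ?D} \<le>
          prob (space (law t) - {\<omega> \<in> space paths. \<exists>n\<ge>1. \<omega> n \<in> A})"
        using ev by (intro finite_measure_mono) (auto simp: sp)
      also have "\<dots> = 1 - prob {\<omega> \<in> space paths. \<exists>n\<ge>1. \<omega> n \<in> A}"
        by (rule prob_compl[OF ev])
      also have "\<dots> \<le> 1 / 2"
        using J[of t] False t by auto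
      finally show ?thesis
        by (simp add: emeasure_eq_measure del: ennreal_half)
    qed
  qed
  \<comment> \<open>Visits to \<open>A\<close> are pushed past each time \<open>n\<close> by
    restarting the chain after one step, hence the quantification over all starts. The base case is
    avoidance probability zero.\<close>
  have "AE \<omega> in law t. (\<exists>m. \<omega> m \<in> ?D) \<or> (\<exists>m\<ge>n. \<omega> m \<in> A)" if "t \<in> space S" for t n
    using that
  proof (induction n arbitrary: t)
    case 0
    note rt = return_in_prob_algebra[OF 0]
    note [measurable_cong] = sets_law[OF rt]
    have "emeasure (law t) {\<omega> \<in> space paths. \<forall>n. \<omega> n \<notin> A \<union> ?D} = 0"
      by (rule emeasure_avoid_eq_0[OF _ _ avoid_le 0]) (auto simp: ennreal_less_one_iff simp del: ennreal_half)
    then have "AE \<omega> in law t. \<not> (\<forall>n. \<omega> n \<notin> A \<union> ?D)"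
      by (subst AE_iff_measurable[OF _ refl]) (simp_all add: space_paths_law[OF rt])
    then show ?case by eventually_elim blast
  next
    case (Suc n)
    show ?case
    proof (subst AE_law_Cons[OF Suc.prems])
      show "AE y in P t. AE \<omega> in law y. (\<exists>m. case_nat t \<omega> m \<in> ?D) \<or> (\<exists>m\<ge>Suc n. case_nat t \<omega> m \<in> A)"
      proof (rule AE_I2)
        fix y assume "y \<in> space (P t)"
        then have "y \<in> space S" using space_kernel[OF Suc.prems] by simp
        from Suc.IH[OF this]
        show "AE \<omega> in law y. (\<exists>m. case_nat t \<omega> m \<in> ?D) \<or> (\<exists>m\<ge>Suc n. case_nat t \<omega> m \<in> A)"
        proof eventually_elim
          case (elim \<omega>)
          then show ?case
            by (metis Suc_le_mono nat.case(2))
        qed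
      qed
    qed measurable
  qed
  then have *: "AE \<omega> in law s. \<forall>n. (\<exists>m. \<omega> m \<in> ?D) \<or> (\<exists>m\<ge>n. \<omega> m \<in> A)"
    using s unfolding AE_all_countable by blast
  show ?thesis
  proof (cases "s \<in> I")
    case True
    from * streett[OF True] show ?thesis
      by eventually_elim blast
  next
    case False
    with s have "AE \<omega> in law s. \<omega> 0 \<in> space S - I"
      by (intro AE_law_start) auto
    then show ?thesis
      by eventually_elim blast
  qed
qed

text \<open>A visit may happen at time 0, a return may not. A visit at time \<open>n\<close> of the
  chain restarted after one step is a return at time \<open>Suc n\<close>.\<close>

lemma AE_law_returns:
  assumes [measurable]: "D \<in> sets S"
    and visits: "\<And>s. s \<in> space S \<Longrightarrow> AE \<omega> in law s. \<exists>n. \<omega> n \<in> D"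
    and s: "s \<in> space S"
  shows "AE \<omega> in law s. \<exists>n\<ge>1. \<omega> n \<in> D"
proof (subst AE_law_Cons[OF s])
  show "AE y in P s. AE \<omega> in law y. \<exists>n\<ge>1. case_nat s \<omega> n \<in> D"
  proof (rule AE_I2)
    fix y assume "y \<in> space (P s)"
    then have "y \<in> space S" using space_kernel[OF s] by simp
    from visits[OF this] show "AE \<omega> in law y. \<exists>n\<ge>1. case_nat s \<omega> n \<in> D"
    proof eventually_elim
      case (elim \<omega>)
      then obtain n where "\<omega> n \<in> D" ..
      then show ?case by (intro exI[of _ "Suc n"]) simp
    qed
  qed
qed measurable

text \<open>Absorption in one step gives membership at each fixed time by induction, and at all
  times together by countability.\<close>

lemma AE_markov_law_always:
  assumes I[measurable]: "I \<in> sets S"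
    and absorbing: "\<And>s. s \<in> I \<Longrightarrow> AE y in P s. y \<in> I"
    and \<mu>: "\<mu> \<in> space (prob_algebra S)" and start: "AE s in \<mu>. s \<in> I"
  shows "AE \<omega> in markov_law S P \<mu>. \<forall>n. \<omega> n \<in> I"
proof -
  have "AE \<omega> in law s. \<omega> n \<in> I" if "s \<in> I" for s n
    using that
  proof (induction n arbitrary: s)
    case 0
    then show ?case using sets.sets_into_space[OF I] by (intro AE_law_start) auto
  next
    case (Suc n)
    then have s: "s \<in> space S" using sets.sets_into_space[OF I] by auto
    show ?case
    proof (subst AE_law_Cons[OF s])
      from absorbing[OF Suc.prems] show "AE y in P s. AE \<omega> in law y. case_nat s \<omega> (Suc n) \<in> I"
        by eventually_elim (simp add: Suc.IH)
    qed measurable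
  qed
  then have "AE \<omega> in law s. \<forall>n. \<omega> n \<in> I" if "s \<in> I" for s
    using that unfolding AE_all_countable by blast
  with start have "AE s in \<mu>. AE \<omega> in law s. \<forall>n. \<omega> n \<in> I"
    by auto
  then show ?thesis
    by (subst AE_markov_law_iff[OF \<mu>]) measurable
qed

end

section \<open>Streett conditions\<close>

lemma return_event_eq: "return_event S A = {\<omega> \<in> space (\<Pi>\<^sub>M n\<in>UNIV. S). \<exists>n\<ge>1. \<omega> n \<in> A}"
proof -
  have "return_time A \<omega> < \<infinity> \<longleftrightarrow> (\<exists>n\<ge>1. \<omega> n \<in> A)" for \<omega>
    unfolding return_time_def Inf_less_iff by auto
  then show ?thesis
    by (simp add: return_event_def path_space_def)
qed

lemma Fin_event_eq:
  "Fin_event S A = {\<omega> \<in> space (\<Pi>\<^sub>M n\<in>UNIV. S). \<exists>n. \<forall>m\<ge>n. \<omega> m \<notin> A}"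
  by (auto simp: Fin_event_def path_space_def)

lemma Inf_event_eq:
  "Inf_event S A = {\<omega> \<in> space (\<Pi>\<^sub>M n\<in>UNIV. S). \<forall>n. \<exists>m\<ge>n. \<omega> m \<in> A}"
  by (auto simp: Inf_event_def path_space_def)

lemma Streett_event_eq:
  "Streett_event S k A B = {\<omega> \<in> space (\<Pi>\<^sub>M n\<in>UNIV. S).
    \<forall>i\<in>{1..k}. (\<exists>n. \<forall>m\<ge>n. \<omega> m \<notin> A i) \<or> (\<forall>n. \<exists>m\<ge>n. \<omega> m \<in> B i)}"
  unfolding Streett_event_def Fin_event_eq Inf_event_eq path_space_def by blast

theorem theorem3p14:
  fixes S \<mu> :: "'a measure" and P :: "'a \<Rightarrow> 'a measure"
    and k :: nat and A B :: "nat \<Rightarrow> 'a set"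
  assumes "\<mu> \<in> space (prob_algebra S)"
    and "P \<in> measurable S (prob_algebra S)"
    and "\<And>i. i \<in> {1..k} \<Longrightarrow> A i \<in> sets S"
    and "\<And>i. i \<in> {1..k} \<Longrightarrow> B i \<in> sets S"
    and "emeasure (markov_law S P \<mu>) (Streett_event S k A B) = 1"
  shows "\<exists>(I :: 'a set) (J :: nat \<Rightarrow> 'a set).
    I \<in> sets S \<and>
    (\<forall>i\<in>{1..k}. J i \<in> sets S \<and> J i \<subseteq> I - A i) \<and>
    emeasure (markov_law S P \<mu>) (always_event S I) = 1 \<and>
    (\<forall>i\<in>{1..k}.
      (SUP s\<in>J i. emeasure (markov_law S P (return S s)) (return_event S (A i))) < 1 \<and>
      (INF s\<in>I. emeasure (markov_law S P (return S s))
        (return_event S (B i \<union> J i \<union> (space S - I)))) = 1)"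
proof -
  interpret markov_kernel S P
    by standard (fact assms(2))
  note \<mu> = assms(1)
  note [measurable] = assms(3,4)
  define Q where "Q \<omega> \<longleftrightarrow>
    (\<forall>i\<in>{1..k}. (\<exists>n. \<forall>m\<ge>n. \<omega> m \<notin> A i) \<or> (\<forall>n. \<exists>m\<ge>n. \<omega> m \<in> B i))" for \<omega> :: "nat \<Rightarrow> 'a"
  have Q [measurable]: "Measurable.pred paths Q"
    unfolding Q_def by measurable
  \<comment> \<open>Tail invariance of the condition. Eventual avoidance is an
    \<open>eventually\<close> statement, insensitive to an index shift; infinitely many visits are
    its negation.\<close>
  have Q_Cons: "Q (case_nat s \<omega>) \<longleftrightarrow> Q \<omega>" for s \<omega>
  proof -
    have fin: "(\<exists>n. \<forall>m\<ge>n. case_nat s \<omega> m \<notin> X) \<longleftrightarrow> (\<exists>n. \<forall>m\<ge>n. \<omega> m \<notin> X)" for X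
      using eventually_sequentially_Suc[of "\<lambda>m. case_nat s \<omega> m \<notin> X"]
      by (simp add: eventually_sequentially)
    from fin[of "- _"] have inf: "(\<forall>n. \<exists>m\<ge>n. case_nat s \<omega> m \<in> X) \<longleftrightarrow> (\<forall>n. \<exists>m\<ge>n. \<omega> m \<in> X)" for X
      using fin[of X] by blast
    show ?thesis
      unfolding Q_def fin inf ..
  qed
  have Q_mu: "AE \<omega> in markov_law S P \<mu>. Q \<omega>"
    using assms(5) emeasure_Collect_eq_1_iff[OF \<mu> Q]
    by (simp add: Streett_event_eq Q_def)
  \<comment> \<open>Stated as a probability equal to 1, the condition is visibly measurable in
    \<open>s\<close>; \<open>I_iff\<close> recovers the almost sure form.\<close>
  define I where "I = {s \<in> space S. emeasure (law s) {\<omega> \<in> space paths. Q \<omega>} = 1}"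
  have I [measurable]: "I \<in> sets S"
    unfolding I_def by measurable
  have I_iff: "s \<in> I \<longleftrightarrow> s \<in> space S \<and> (AE \<omega> in law s. Q \<omega>)" for s
    unfolding I_def using emeasure_Collect_eq_1_iff[OF return_in_prob_algebra Q] by auto
  have start: "AE s in \<mu>. s \<in> I"
  proof -
    have "space \<mu> = space S"
      using \<mu> by (auto simp: space_prob_algebra dest: sets_eq_imp_space_eq)
    with Q_mu show ?thesis
      unfolding AE_markov_law_iff[OF \<mu> Q] by (auto simp: I_iff elim!: AE_mp)
  qed
  \<comment> \<open>Conditioning on the first step makes the prefixed condition hold almost surely
    from almost every successor; \<open>Q_Cons\<close> then drops the prefix.\<close>
  have absorbing: "AE y in P s. y \<in> I" if "s \<in> I" for s
  proof -
    have s: "s \<in> space S" and "AE \<omega> in law s. Q \<omega>"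
      using that by (simp_all add: I_iff)
    then show ?thesis
      unfolding AE_law_Cons[OF s Q] Q_Cons using space_kernel[OF s]
      by (auto simp: I_iff elim!: AE_mp)
  qed
  \<comment> \<open>Needed for the final infimum, which over an empty \<open>I\<close> would be
    infinite instead of 1.\<close>
  have I_ne: "I \<noteq> {}"
  proof
    assume "I = {}"
    with start have "AE s in \<mu>. False" by simp
    moreover have "prob_space \<mu>" using \<mu> by (simp add: space_prob_algebra)
    ultimately show False
      by (simp add: prob_space.AE_False)
  qed
  \<comment> \<open>Any threshold strictly between 0 and 1 would serve: it bounds the supremum over
    \<open>J i\<close> away from 1 and the probability of reaching \<open>A i\<close> from the rest
    of \<open>I - A i\<close> away from 0.\<close>
  define J where "J i = {s \<in> I. s \<notin> A i \<and> measure (law s) {\<omega> \<in> space paths. \<exists>n\<ge>1. \<omega> n \<in> A i} \<le> 1 / 2}" for i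
  show ?thesis
  proof (intro exI conjI ballI)
    show "I \<in> sets S" by (fact I)
    show "emeasure (markov_law S P \<mu>) (always_event S I) = 1"
      using AE_markov_law_always[OF I absorbing \<mu> start]
      unfolding always_event_def path_space_def
      by (subst emeasure_Collect_eq_1_iff[OF \<mu>]) measurable
  next
    fix i assume i: "i \<in> {1..k}"
    note [measurable] = assms(3,4)[OF i]
    have "J i = I \<inter> {s \<in> space S. s \<notin> A i \<and> measure (law s) {\<omega> \<in> space paths. \<exists>n\<ge>1. \<omega> n \<in> A i} \<le> 1 / 2}"
      using sets.sets_into_space[OF I] by (auto simp: J_def)
    then show J [measurable]: "J i \<in> sets S" by simp
    show "J i \<subseteq> I - A i" by (auto simp: J_def)
    have "emeasure (law s) (return_event S (A i)) \<le> ennreal (1 / 2)" if "s \<in> J i" for s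
    proof -
      have "s \<in> space S"
        using that by (auto simp: J_def I_iff)
      then interpret prob_space "law s"
        by (intro prob_space_markov_law kernel return_in_prob_algebra)
      show ?thesis
        using that by (simp add: return_event_eq J_def emeasure_eq_measure del: ennreal_half)
    qed
    \<comment> \<open>This covers an empty \<open>J i\<close> too, where the supremum in
      \<open>ennreal\<close> is 0.\<close>
    then have "(SUP s\<in>J i. emeasure (law s) (return_event S (A i))) \<le> ennreal (1 / 2)"
      by (rule SUP_least)
    also have "\<dots> < 1"
      by (simp add: ennreal_less_one_iff del: ennreal_half)
    finally show "(SUP s\<in>J i. emeasure (law s) (return_event S (A i))) < 1" .
    let ?D = "B i \<union> J i \<union> (space S - I)"
    \<comment> \<open>States of \<open>I - A i\<close> left out of \<open>J i\<close> reach
      \<open>A i\<close> with probability above 1/2, as \<open>AE_law_visits\<close> requires; pair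
      \<open>i\<close> of \<open>Q\<close> supplies its Streett alternative.\<close>
    have "AE \<omega> in law s. \<exists>n. \<omega> n \<in> ?D" if "s \<in> space S" for s
    proof (rule AE_law_visits[of "A i"])
      fix t assume "t \<in> I"
      then have "AE \<omega> in law t. Q \<omega>" by (simp add: I_iff)
      then show "AE \<omega> in law t. (\<exists>n. \<forall>m\<ge>n. \<omega> m \<notin> A i) \<or> (\<forall>n. \<exists>m\<ge>n. \<omega> m \<in> B i)"
        by eventually_elim (use i in \<open>auto simp: Q_def\<close>)
    qed (use that in \<open>auto simp: J_def\<close>)
    then have "AE \<omega> in law s. \<exists>n\<ge>1. \<omega> n \<in> ?D" if "s \<in> space S" for s
      using that by (intro AE_law_returns) auto
    then have "emeasure (law s) (return_event S ?D) = 1" if "s \<in> I" for s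
      using that unfolding return_event_eq I_iff
      by (subst emeasure_Collect_eq_1_iff[OF return_in_prob_algebra]) simp_all
    then show "(INF s\<in>I. emeasure (law s) (return_event S ?D)) = 1"
      using I_ne by simp
  qed
qed

end
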